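(* Suppose there exists a Hadamard matrix of order $n$. Then there exist a twin Deza graph with parameters $\left((2n-1)n,\ (n-1)n,\ \frac{n(n-1)}{2},\ \frac{n(n-2)}{2}\right)$, and a Siamese twin Deza reflexive graph with parameters $\left((2n-1)n,\ n^2,\ \frac{n(n+1)}{2},\ \frac{n^2}{2}\right)$.
   Context: A Hadamard matrix of order $n$ is an $n\times n$ $(1,-1)$-matrix $H$ with $HH^t=nI_n$. A Deza graph with parameters $(v,k,b,a)$, $a\le b$, is a $k$-regular simple graph on $v$ vertices such that any two distinct vertices have $a$ or $b$ common neighbours; equivalently its adjacency matrix $M$ is a symmetric $(0,1)$-matrix of order $v$ with zero diagonal, all row sums equal to $k$, and all off-diagonal entries of $M^2$ in $\{a,b\}$. A reflexive graph is obtained from a graph by including a loop at every vertex: if $A$ is the adjacency matrix of a graph on $v$ vertices, then $A+I_v$ is the adjacency matrix of the corresponding reflexive graph. A Deza reflexive graph with parameters $(v,k,b,a)$ is a reflexive graph on $v$ vertices whose adjacency matrix $M$ (symmetric, with all diagonal entries $1$) has all row sums equal to $k$ and all off-diagonal entries of $M^2$ in $\{a,b\}$. A $(0,\pm1)$-matrix $T$ is a twin Deza graph (with given parameters) if $T=K-L$, where $K,L$ are non-zero disjoint $(0,1)$-matrices and both $K$ and $L$ are adjacency matrices of Deza graphs with the same (given) parameters. Disjoint means that no two of the matrices have an entry $1$ in the same position. A $(0,\pm1)$-matrix $S$ is a Siamese twin Deza reflexive graph (with given parameters), sharing the entries of $N$, if $S=N+K-L$, where $N,K,L$ are non-zero disjoint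 $(0,1)$-matrices and both $N+K$ and $N+L$ are adjacency matrices of Deza reflexive graphs with the same (given) parameters.
   Formalization: The order n is assumed to be at least 2: for n = 1 the matrix (1) is Hadamard, but the claim fails, since n(n-2)/2 is not an integer and non-zero disjoint matrices K, L (and N) of order 1 with the required diagonals do not exist. *)

theory Defs
  imports "Jordan_Normal_Form.Matrix"
begin

definition zero_one_mat :: "nat \<Rightarrow> int mat \<Rightarrow> bool" where
  "zero_one_mat v A \<longleftrightarrow>
     A \<in> carrier_mat v v \<and> (\<forall>i<v. \<forall>j<v. A $$ (i, j) = 0 \<or> A $$ (i, j) = 1)"

definition disjoint_mat :: "nat \<Rightarrow> int mat \<Rightarrow> int mat \<Rightarrow> bool" where
  "disjoint_mat v A B \<longleftrightarrow> (\<forall>i<v. \<forall>j<v. \<not> (A $$ (i, j) = 1 \<and> B $$ (i, j) = 1))"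

definition hadamard_mat :: "nat \<Rightarrow> int mat \<Rightarrow> bool" where
  "hadamard_mat n H \<longleftrightarrow>
     H \<in> carrier_mat n n \<and>
     (\<forall>i<n. \<forall>j<n. H $$ (i, j) = 1 \<or> H $$ (i, j) = -1) \<and>
     H * transpose_mat H = int n \<cdot>\<^sub>m 1\<^sub>m n"

text \<open>A simple graph on the vertices \<open>0, \<dots>, v - 1\<close> is given by its set of edges, each
  edge being a two-element set of vertices.\<close>

definition simple_graph :: "nat \<Rightarrow> nat set set \<Rightarrow> bool" where
  "simple_graph v E \<longleftrightarrow> E \<subseteq> {e. e \<subseteq> {..<v} \<and> card e = 2}"

definition neighbours :: "nat set set \<Rightarrow> nat \<Rightarrow> nat set" where
  "neighbours E x = {y. {x, y} \<in> E}"

definition adj_mat :: "nat \<Rightarrow> nat set set \<Rightarrow> int mat" where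
  "adj_mat v E = mat v v (\<lambda>(i, j). if {i, j} \<in> E then 1 else 0)"

definition deza_graph :: "nat \<Rightarrow> nat \<Rightarrow> nat \<Rightarrow> nat \<Rightarrow> nat set set \<Rightarrow> bool" where
  "deza_graph v k b a E \<longleftrightarrow>
     a \<le> b \<and> simple_graph v E \<and>
     (\<forall>x<v. card (neighbours E x) = k) \<and>
     (\<forall>x<v. \<forall>y<v. x \<noteq> y \<longrightarrow> card (neighbours E x \<inter> neighbours E y) \<in> {a, b})"

definition deza_adj_mat :: "nat \<Rightarrow> nat \<Rightarrow> nat \<Rightarrow> nat \<Rightarrow> int mat \<Rightarrow> bool" where
  "deza_adj_mat v k b a M \<longleftrightarrow> (\<exists>E. deza_graph v k b a E \<and> M = adj_mat v E)"

text \<open>The loops of a reflexive graph count once in the row sums and in the square.\<close>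

definition deza_reflexive_adj_mat :: "nat \<Rightarrow> nat \<Rightarrow> nat \<Rightarrow> nat \<Rightarrow> int mat \<Rightarrow> bool" where
  "deza_reflexive_adj_mat v k b a M \<longleftrightarrow>
     (\<exists>E. simple_graph v E \<and> M = adj_mat v E + 1\<^sub>m v) \<and>
     (\<forall>i<v. (\<Sum>j<v. M $$ (i, j)) = int k) \<and>
     (\<forall>i<v. \<forall>j<v. i \<noteq> j \<longrightarrow> (M * M) $$ (i, j) \<in> {int a, int b})"

definition twin_deza_graph :: "nat \<Rightarrow> nat \<Rightarrow> nat \<Rightarrow> nat \<Rightarrow> int mat \<Rightarrow> bool" where
  "twin_deza_graph v k b a T \<longleftrightarrow>
     (\<exists>K L. zero_one_mat v K \<and> zero_one_mat v L \<and>
        K \<noteq> 0\<^sub>m v v \<and> L \<noteq> 0\<^sub>m v v \<and>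
        disjoint_mat v K L \<and>
        T = K - L \<and>
        deza_adj_mat v k b a K \<and> deza_adj_mat v k b a L)"

text \<open>\<open>N\<close> is the matrix whose entries the two reflexive graphs share.\<close>

definition siamese_twin_deza_reflexive_graph ::
    "nat \<Rightarrow> nat \<Rightarrow> nat \<Rightarrow> nat \<Rightarrow> int mat \<Rightarrow> int mat \<Rightarrow> bool" where
  "siamese_twin_deza_reflexive_graph v k b a N S \<longleftrightarrow>
     (\<exists>K L. zero_one_mat v N \<and> zero_one_mat v K \<and> zero_one_mat v L \<and>
        N \<noteq> 0\<^sub>m v v \<and> K \<noteq> 0\<^sub>m v v \<and> L \<noteq> 0\<^sub>m v v \<and>
        disjoint_mat v N K \<and> disjoint_mat v N L \<and> disjoint_mat v K L \<and>
        S = N + K - L \<and>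
        deza_reflexive_adj_mat v k b a (N + K) \<and> deza_reflexive_adj_mat v k b a (N + L))"

lemma adj_mat_carrier [simp]: "adj_mat v E \<in> carrier_mat v v"
  by (simp add: adj_mat_def)

lemma neighbours_subset: "simple_graph v E \<Longrightarrow> neighbours E x \<subseteq> {..<v}"
  by (auto simp: simple_graph_def neighbours_def)

lemma adj_mat_row_sum:
  assumes "simple_graph v E" "i < v"
  shows "(\<Sum>j<v. adj_mat v E $$ (i, j)) = int (card (neighbours E i))"
proof -
  have "(\<Sum>j<v. adj_mat v E $$ (i, j)) = (\<Sum>j<v. if j \<in> neighbours E i then 1 else 0)"
    using assms by (intro sum.cong) (auto simp: adj_mat_def neighbours_def)
  also have "\<dots> = int (card ({..<v} \<inter> neighbours E i))"
    by (subst sum.inter_restrict [symmetric]) auto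
  also have "{..<v} \<inter> neighbours E i = neighbours E i"
    using neighbours_subset [OF assms(1)] by blast
  finally show ?thesis .
qed

lemma adj_mat_square:
  assumes "simple_graph v E" "i < v" "j < v"
  shows "(adj_mat v E * adj_mat v E) $$ (i, j) = int (card (neighbours E i \<inter> neighbours E j))"
proof -
  have "(adj_mat v E * adj_mat v E) $$ (i, j) =
      (\<Sum>l\<in>{0..<v}. adj_mat v E $$ (i, l) * adj_mat v E $$ (l, j))"
    using assms by (simp add: scalar_prod_def adj_mat_def)
  also have "\<dots> = (\<Sum>l<v. if l \<in> neighbours E i \<inter> neighbours E j then 1 else 0)"
    using assms
    by (intro sum.cong) (auto simp: adj_mat_def neighbours_def insert_commute)
  also have "\<dots> = int (card ({..<v} \<inter> (neighbours E i \<inter> neighbours E j)))"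
    by (subst sum.inter_restrict [symmetric]) auto
  also have "{..<v} \<inter> (neighbours E i \<inter> neighbours E j) = neighbours E i \<inter> neighbours E j"
    using neighbours_subset [OF assms(1)] by blast
  finally show ?thesis .
qed

lemma ex_adj_mat_iff:
  "(\<exists>E. simple_graph v E \<and> M = adj_mat v E) \<longleftrightarrow>
     zero_one_mat v M \<and> transpose_mat M = M \<and> (\<forall>i<v. M $$ (i, i) = 0)"
proof
  assume "\<exists>E. simple_graph v E \<and> M = adj_mat v E"
  then show "zero_one_mat v M \<and> transpose_mat M = M \<and> (\<forall>i<v. M $$ (i, i) = 0)"
    by (auto simp: zero_one_mat_def adj_mat_def simple_graph_def insert_commute intro!: eq_matI)
next
  assume *: "zero_one_mat v M \<and> transpose_mat M = M \<and> (\<forall>i<v. M $$ (i, i) = 0)"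
  define E where "E = {{i, j} |i j. i < v \<and> j < v \<and> M $$ (i, j) = 1}"
  have sym: "M $$ (i, j) = M $$ (j, i)" if "i < v" "j < v" for i j
    using * that by (metis carrier_matD index_transpose_mat(1) zero_one_mat_def)
  have "simple_graph v E"
    using * by (fastforce simp: simple_graph_def E_def card_2_iff)
  moreover have "{i, j} \<in> E \<longleftrightarrow> M $$ (i, j) = 1" if "i < v" "j < v" for i j
    using sym that by (auto simp: E_def doubleton_eq_iff)
  then have "M = adj_mat v E"
    using * by (intro eq_matI) (auto simp: adj_mat_def zero_one_mat_def)
  ultimately show "\<exists>E. simple_graph v E \<and> M = adj_mat v E" by blast
qed

lemma deza_adj_mat_iff:
  "deza_adj_mat v k b a M \<longleftrightarrow>
     a \<le> b \<and> zero_one_mat v M \<and> transpose_mat M = M \<and> (\<forall>i<v. M $$ (i, i) = 0) \<and>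
     (\<forall>i<v. (\<Sum>j<v. M $$ (i, j)) = int k) \<and>
     (\<forall>i<v. \<forall>j<v. i \<noteq> j \<longrightarrow> (M * M) $$ (i, j) \<in> {int a, int b})"
proof -
  have "deza_adj_mat v k b a M \<longleftrightarrow>
     a \<le> b \<and> (\<exists>E. simple_graph v E \<and> M = adj_mat v E) \<and>
     (\<forall>i<v. (\<Sum>j<v. M $$ (i, j)) = int k) \<and>
     (\<forall>i<v. \<forall>j<v. i \<noteq> j \<longrightarrow> (M * M) $$ (i, j) \<in> {int a, int b})"
    unfolding deza_adj_mat_def deza_graph_def
    by (auto simp: adj_mat_row_sum adj_mat_square) metis+
  then show ?thesis
    unfolding ex_adj_mat_iff by blast
qed

text \<open>The order of a Hadamard matrix is even once it exceeds 1, so halves such as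
  \<open>n * (n - 2) div 2\<close> are exact.\<close>

lemma hadamard_mat_even:
  assumes "hadamard_mat n H" "2 \<le> n"
  shows "even n"
proof -
  have H: "H \<in> carrier_mat n n" "H * transpose_mat H = int n \<cdot>\<^sub>m 1\<^sub>m n"
    and pm: "\<And>i j. i < n \<Longrightarrow> j < n \<Longrightarrow> H $$ (i, j) = 1 \<or> H $$ (i, j) = -1"
    using assms(1) by (auto simp: hadamard_mat_def)
  have "(H * transpose_mat H) $$ (0, 1) = (\<Sum>l\<in>{0..<n}. H $$ (0, l) * H $$ (1, l))"
    using H(1) assms(2) by (simp add: scalar_prod_def)
  moreover have "(H * transpose_mat H) $$ (0, 1) = 0"
    using assms(2) by (simp add: H(2))
  moreover have "odd (H $$ (0, l) * H $$ (1, l))" if "l \<in> {0..<n}" for l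
    using pm [of 0 l] pm [of 1 l] assms(2) that by auto
  then have "{l \<in> {0..<n}. odd (H $$ (0, l) * H $$ (1, l))} = {0..<n}" by blast
  then have "even (\<Sum>l\<in>{0..<n}. H $$ (0, l) * H $$ (1, l)) \<longleftrightarrow> even n"
    by (simp only: even_sum_iff finite_atLeastLessThan card_atLeastLessThan diff_zero)
  ultimately show ?thesis by simp
qed

end

theory Submission
  imports Defs "Jordan_Normal_Form.Determinant"
begin

text \<open>
  Normalise the Hadamard matrix so that its first row is constant, and let
  \<open>C\<^sub>s = r\<^sub>s\<^sup>t r\<^sub>s\<close> for its rows \<open>r\<^sub>s\<close>. The \<open>C\<^sub>s\<close> are symmetric, \<open>C\<^sub>s C\<^sub>t = 0\<close> for \<open>s \<noteq> t\<close>,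
  \<open>C\<^sub>s\<^sup>2 = n C\<^sub>s\<close>, and their sum is \<open>n I\<close>. Put a zero block on the diagonal of a
  \<open>(2 n - 1) \<times> (2 n - 1)\<close> block matrix \<open>T\<close> and \<open>C\<^sub>s\<close> in position \<open>(p, q)\<close>, where
  \<open>s \<in> {1, \<dots>, n - 1}\<close> is the cyclic distance of \<open>p\<close> and \<open>q\<close> modulo \<open>2 n - 1\<close>. As \<open>2 n - 1\<close> is
  odd, distinct residues have exactly one midpoint, so the block \<open>(p, q)\<close> of \<open>T\<^sup>2\<close> is
  \<open>n C\<^sub>s\<close> for a single \<open>s\<close>, and the diagonal blocks of \<open>T\<^sup>2\<close> are \<open>2 n (n I - J)\<close>. The positive
  and negative parts of \<open>T\<close> are the twins; filling the diagonal blocks with ones gives the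
  Siamese twins.
\<close>

section \<open>Cyclic distances and midpoints modulo an odd number\<close>

definition cyclic_dist :: "nat \<Rightarrow> nat \<Rightarrow> nat \<Rightarrow> nat" where
  "cyclic_dist m p q = (let d = (if p \<le> q then q - p else p - q) in min d (m - d))"

lemma cyclic_dist_commute: "cyclic_dist m p q = cyclic_dist m q p"
  by (simp add: cyclic_dist_def)

lemma cyclic_dist_bounds:
  assumes "p < 2 * n - 1" "q < 2 * n - 1" "p \<noteq> q"
  shows "cyclic_dist (2 * n - 1) p q \<in> {1..<n}"
  using assms by (auto simp: cyclic_dist_def Let_def min_def)

text \<open>Equal distances mean displacements from \<open>r\<close> that agree up to sign modulo
  \<open>m\<close>. Agreement in sign would force \<open>p = q\<close>, so \<open>2 * r\<close> is
  congruent to \<open>p + q\<close>; both lie below \<open>2 * m\<close>, hence differ by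
  \<open>0\<close> or \<open>m\<close>.\<close>

lemma cyclic_dist_eq_iff:
  assumes "p < m" "q < m" "r < m" "p \<noteq> q"
  shows "cyclic_dist m p r = cyclic_dist m r q \<longleftrightarrow>
    2 * r = p + q \<or> 2 * r = p + q + m \<or> 2 * r + m = p + q"
proof -
  have min_eq: "min a (m - a) = min b (m - b) \<longleftrightarrow> a = b \<or> a + b = m" if "a < m" "b < m" for a b
    using that by (auto simp: min_def)
  show ?thesis
    using assms by (auto simp: cyclic_dist_def Let_def min_eq)
qed

text \<open>Since 2 is invertible modulo the odd number \<open>2 * n - 1\<close>, the congruence of
  \<open>2 * r\<close> and \<open>p + q\<close> has one solution, and \<open>r = p\<close> or
  \<open>r = q\<close> would force \<open>p = q\<close>.\<close>

lemma cyclic_midpoint: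
  assumes "p < 2 * n - 1" "q < 2 * n - 1" "p \<noteq> q"
  shows "\<exists>!r. r < 2 * n - 1 \<and> r \<noteq> p \<and> r \<noteq> q \<and>
    cyclic_dist (2 * n - 1) p r = cyclic_dist (2 * n - 1) r q"
proof -
  define m where "m = 2 * n - 1"
  have m: "odd m" "p < m" "q < m"
    using assms by (auto simp: m_def)
  \<comment> \<open>The branches pick the even one among \<open>p + q\<close> and its shifts by
    \<open>m\<close> whose half lies below \<open>m\<close>.\<close>
  define r where "r = (if even (p + q) then (p + q) div 2
    else if p + q < m then (p + q + m) div 2 else (p + q - m) div 2)"
  have "2 * r = (if even (p + q) then p + q else if p + q < m then p + q + m else p + q - m)"
    using m(1) by (simp add: r_def)
  then have r: "2 * r' = p + q \<or> 2 * r' = p + q + m \<or> 2 * r' + m = p + q \<longleftrightarrow> r' = r"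
    if "r' < m" for r'
  proof -
    \<comment> \<open>Equations whose right-hand sides differ by \<open>m\<close> cannot both hold,
      as \<open>m\<close> is odd; those differing by \<open>2 * m\<close> are separated by the range
      conditions.\<close>
    have parity: "2 * i \<noteq> 2 * j + m" for i j
      using m(1) by (metis dvd_add_right_iff dvd_triv_left)
    consider "2 * r = p + q" | "p + q < m" "2 * r = p + q + m" | "2 * r + m = p + q"
      using \<open>2 * r = _\<close> by (auto split: if_splits)
    then show ?thesis
    proof cases
      case 1
      then show ?thesis using parity [of r r'] parity [of r' r] by auto
    next
      case 2
      then show ?thesis using parity [of r r'] by auto
    next
      case 3
      then show ?thesis using parity [of r' r] that by auto
    qed
  qed
  have "r < m" "r \<noteq> p" "r \<noteq> q"
    using \<open>2 * r = _\<close> m assms(3) by (auto split: if_splits)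
  then show ?thesis
    unfolding m_def [symmetric] using m assms(3) by (auto simp: cyclic_dist_eq_iff r)
qed

text \<open>The four equations express \<open>r = p + s\<close> and \<open>r = p - s\<close> modulo
  \<open>m\<close> without truncated subtraction; \<open>2 * s < m\<close> makes \<open>s\<close>
  the shorter way round.\<close>

lemma cyclic_dist_eqI:
  assumes "r = p + s \<or> p = r + s \<or> r + m = p + s \<or> p + m = r + s" "2 * s < m" "p < m" "r < m"
  shows "cyclic_dist m p r = s"
  using assms by (elim disjE) (simp_all add: cyclic_dist_def Let_def min_def, arith+)

text \<open>Each distance \<open>s\<close> is attained exactly twice, at \<open>p + s\<close> and
  \<open>p - s\<close> modulo \<open>2 * n - 1\<close>; these are the maps \<open>u\<close> and
  \<open>v\<close>.\<close>

lemma sum_cyclic_dist: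
  fixes f :: "nat \<Rightarrow> 'a :: comm_semiring_1"
  assumes "p < 2 * n - 1"
  shows "(\<Sum>r\<in>{..<2 * n - 1} - {p}. f (cyclic_dist (2 * n - 1) p r)) = 2 * (\<Sum>s\<in>{1..<n}. f s)"
proof -
  define u where "u s = (if p + s < 2 * n - 1 then p + s else p + s - (2 * n - 1))" for s
  define v where "v s = (if s \<le> p then p - s else p + (2 * n - 1) - s)" for s
  have inj: "inj_on u {1..<n}" "inj_on v {1..<n}"
    using assms by (auto simp: inj_on_def u_def v_def split: if_splits)
  have disj: "u ` {1..<n} \<inter> v ` {1..<n} = {}"
    using assms by (auto simp: u_def v_def split: if_splits)
  have dist: "cyclic_dist (2 * n - 1) p (u s) = s" "cyclic_dist (2 * n - 1) p (v s) = s"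
    if "s \<in> {1..<n}" for s
    using assms that by (auto simp: u_def v_def intro!: cyclic_dist_eqI)
  \<comment> \<open>One inclusion suffices, since the disjoint images together have
    \<open>2 * (n - 1)\<close> elements, as many as the left side.\<close>
  have "{..<2 * n - 1} - {p} = u ` {1..<n} \<union> v ` {1..<n}" (is "?A = ?B")
  proof (rule card_seteq [symmetric])
    show "?B \<subseteq> ?A"
      using assms by (auto simp: u_def v_def)
    have "card ?B = 2 * (n - 1)"
      by (simp add: card_Un_disjoint disj card_image inj del: One_nat_def)
    then show "card ?A \<le> card ?B"
      using assms by simp
  qed simp
  then show ?thesis
    by (simp add: sum.union_disjoint disj sum.reindex inj dist flip: mult_2 del: One_nat_def)
qed

section \<open>Splitting indices into blocks, and normalising a Hadamard matrix\<close>

lemma sum_div_mod_blocks: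
  fixes f :: "nat \<Rightarrow> nat \<Rightarrow> 'a :: comm_monoid_add"
  shows "(\<Sum>i<m * n. f (i div n) (i mod n)) = (\<Sum>p<m. \<Sum>x<n. f p x)"
proof -
  have "(\<Sum>i\<in>{p * n..<p * n + n}. f (i div n) (i mod n)) = (\<Sum>x<n. f p x)" for p
    by (rule sum.reindex_bij_witness [where i = "\<lambda>x. p * n + x" and j = "\<lambda>i. i - p * n"])
      (auto simp: div_nat_eqI mod_nat_eqI div_mult_self3 dest!: le_Suc_ex)
  then show ?thesis
    by (simp flip: sum.nat_group)
qed

text \<open>Over the rationals the transpose divided by \<open>n\<close> is a right inverse of a
  square matrix, hence a left inverse; injectivity of the embedding brings the identity back to the
  integers.\<close>

lemma hadamard_mat_transpose:
  assumes "hadamard_mat n H" "n > 0"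
  shows "transpose_mat H * H = int n \<cdot>\<^sub>m 1\<^sub>m n"
proof -
  have H: "H \<in> carrier_mat n n" "H * transpose_mat H = int n \<cdot>\<^sub>m 1\<^sub>m n"
    using assms by (auto simp: hadamard_mat_def)
  define R where "R = map_mat rat_of_int H"
  define S where "S = map_mat rat_of_int (transpose_mat H)"
  have carrier: "R \<in> carrier_mat n n" "S \<in> carrier_mat n n"
    using H(1) by (simp_all add: R_def S_def)
  have "R * S = map_mat rat_of_int (H * transpose_mat H)"
    unfolding R_def S_def using H(1) by (intro of_int_hom.mat_hom_mult [symmetric]) auto
  then have RS: "R * S = rat_of_nat n \<cdot>\<^sub>m 1\<^sub>m n"
    unfolding H(2) by (auto intro!: eq_matI)
  have "R * ((1 / rat_of_nat n) \<cdot>\<^sub>m S) = (1 / rat_of_nat n) \<cdot>\<^sub>m (R * S)"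
    using carrier by (rule mult_smult_distrib)
  also have "\<dots> = 1\<^sub>m n"
    unfolding RS using assms(2) by (auto intro!: eq_matI)
  finally have "((1 / rat_of_nat n) \<cdot>\<^sub>m S) * R = 1\<^sub>m n"
    by (rule mat_mult_left_right_inverse [OF carrier(1) smult_carrier_mat [OF carrier(2)]])
  then have SR: "(1 / rat_of_nat n) \<cdot>\<^sub>m (S * R) = 1\<^sub>m n"
    using carrier by (simp add: mult_smult_assoc_mat)
  have "map_mat rat_of_int (transpose_mat H * H) = S * R"
    unfolding R_def S_def using H(1) by (intro of_int_hom.mat_hom_mult) auto
  also have "\<dots> = rat_of_nat n \<cdot>\<^sub>m ((1 / rat_of_nat n) \<cdot>\<^sub>m (S * R))"
    using carrier assms(2) by (intro eq_matI) auto
  finally have eq: "map_mat rat_of_int (transpose_mat H * H) = rat_of_nat n \<cdot>\<^sub>m 1\<^sub>m n"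
    unfolding SR .
  show ?thesis
  proof (rule eq_matI)
    fix i j
    assume "i < dim_row (int n \<cdot>\<^sub>m 1\<^sub>m n)" "j < dim_col (int n \<cdot>\<^sub>m 1\<^sub>m n)"
    then have ij: "i < n" "j < n" by auto
    have "rat_of_int ((transpose_mat H * H) $$ (i, j)) =
        map_mat rat_of_int (transpose_mat H * H) $$ (i, j)"
      using ij H(1) by simp
    also have "\<dots> = rat_of_int ((int n \<cdot>\<^sub>m 1\<^sub>m n) $$ (i, j))"
      unfolding eq using ij by simp
    finally show "(transpose_mat H * H) $$ (i, j) = (int n \<cdot>\<^sub>m 1\<^sub>m n) $$ (i, j)"
      by (simp only: of_int_eq_iff)
  qed (use H(1) in auto)
qed

text \<open>The matrix \<open>C\<^sub>s\<close> appears only through its entries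
  \<open>h s x * h s y\<close>. Then \<open>rows\<close> governs the products of the
  \<open>C\<^sub>s\<close>, and \<open>columns\<close> their sum.\<close>

locale normalized_hadamard =
  fixes n :: nat and h :: "nat \<Rightarrow> nat \<Rightarrow> int"
  assumes order_ge_2: "n \<ge> 2"
    and entries: "\<lbrakk>s < n; x < n\<rbrakk> \<Longrightarrow> h s x = 1 \<or> h s x = -1"
    and first_row: "x < n \<Longrightarrow> h 0 x = 1"
    and rows: "\<lbrakk>s < n; t < n\<rbrakk> \<Longrightarrow> (\<Sum>x<n. h s x * h t x) = (if s = t then int n else 0)"
    and columns: "\<lbrakk>x < n; y < n\<rbrakk> \<Longrightarrow> (\<Sum>s<n. h s x * h s y) = (if x = y then int n else 0)"

text \<open>Column \<open>x\<close> is multiplied by its own first entry. This sign squares to 1, so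
  row products are unchanged, while column products only gain a sign, which is 1 for
  \<open>x = y\<close>.\<close>

lemma hadamard_mat_normalize:
  assumes "hadamard_mat n H" "n \<ge> 2"
  shows "normalized_hadamard n (\<lambda>s x. H $$ (0, x) * H $$ (s, x))"
proof
  have H: "H \<in> carrier_mat n n" "H * transpose_mat H = int n \<cdot>\<^sub>m 1\<^sub>m n"
    and pm: "\<And>i j. i < n \<Longrightarrow> j < n \<Longrightarrow> H $$ (i, j) = 1 \<or> H $$ (i, j) = -1"
    using assms(1) by (auto simp: hadamard_mat_def)
  have sq: "H $$ (0, x) * H $$ (0, x) = 1" if "x < n" for x
    using pm [of 0 x] that by auto
  show "n \<ge> 2" by fact
  show "H $$ (0, x) * H $$ (s, x) = 1 \<or> H $$ (0, x) * H $$ (s, x) = -1" if "s < n" "x < n" for s x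
    using pm [of 0 x] pm [of s x] that by auto
  show "H $$ (0, x) * H $$ (0, x) = 1" if "x < n" for x
    using sq that .
  show "(\<Sum>x<n. H $$ (0, x) * H $$ (s, x) * (H $$ (0, x) * H $$ (t, x))) =
      (if s = t then int n else 0)" if "s < n" "t < n" for s t
  proof -
    have "(\<Sum>x<n. H $$ (0, x) * H $$ (s, x) * (H $$ (0, x) * H $$ (t, x))) =
        (\<Sum>x<n. (H $$ (0, x) * H $$ (0, x)) * (H $$ (s, x) * H $$ (t, x)))"
      by (simp add: mult_ac)
    also have "\<dots> = (\<Sum>x<n. H $$ (s, x) * H $$ (t, x))"
      by (simp add: sq)
    also have "\<dots> = (H * transpose_mat H) $$ (s, t)"
      using H(1) that by (simp add: scalar_prod_def atLeast0LessThan)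
    finally show ?thesis
      using that by (simp add: H(2))
  qed
  show "(\<Sum>s<n. H $$ (0, x) * H $$ (s, x) * (H $$ (0, y) * H $$ (s, y))) =
      (if x = y then int n else 0)" if "x < n" "y < n" for x y
  proof -
    have "(\<Sum>s<n. H $$ (0, x) * H $$ (s, x) * (H $$ (0, y) * H $$ (s, y))) =
        H $$ (0, x) * H $$ (0, y) * (\<Sum>s<n. H $$ (s, x) * H $$ (s, y))"
      by (simp add: sum_distrib_left mult_ac)
    also have "(\<Sum>s<n. H $$ (s, x) * H $$ (s, y)) = (transpose_mat H * H) $$ (x, y)"
      using H(1) that by (simp add: scalar_prod_def atLeast0LessThan)
    finally show ?thesis
      using that sq assms by (cases "x = y") (simp_all add: hadamard_mat_transpose)
  qed
qed

section \<open>Entries, row sums and products of the blocks\<close>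

context normalized_hadamard
begin

definition m :: nat where
  "m = 2 * n - 1"

lemma int_m: "int m = 2 * int n - 1"
  using order_ge_2 by (simp add: m_def)

lemma m_pos: "0 < m"
  using order_ge_2 by (simp add: m_def)

lemma dist_bounds:
  assumes "p < m" "q < m" "p \<noteq> q"
  shows "cyclic_dist m p q \<in> {1..<n}"
  using cyclic_dist_bounds assms unfolding m_def .

lemma row_sum_zero:
  assumes "s \<in> {1..<n}"
  shows "(\<Sum>x<n. h s x) = 0"
  using rows [of s 0] assms by (simp add: first_row)

text \<open>Off the diagonal the block is \<open>(J + e C\<^sub>s) / 2\<close>, marking the entries
  of \<open>C\<^sub>s\<close> equal to \<open>e\<close>. The constant \<open>c\<close> fills the
  diagonal blocks: 0 for the twins, 1 for the reflexive graphs.\<close>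

definition block_entry :: "int \<Rightarrow> int \<Rightarrow> nat \<Rightarrow> nat \<Rightarrow> nat \<Rightarrow> nat \<Rightarrow> int" where
  "block_entry e c p x q y =
     (if p = q then c
      else (1 + e * (h (cyclic_dist m p q) x * h (cyclic_dist m p q) y)) div 2)"

lemma block_entry_commute: "block_entry e c p x q y = block_entry e c q y p x"
  by (simp add: block_entry_def cyclic_dist_commute mult_ac)

text \<open>The numerator is 0 or 2, so the division is exact. Later sums carry a factor 2 or 4 to
  avoid \<open>div\<close>.\<close>

lemma double_block_entry:
  assumes "p < m" "q < m" "x < n" "y < n" "e \<in> {1, -1}"
  shows "2 * block_entry e c p x q y =
    (if p = q then 2 * c else 1 + e * (h (cyclic_dist m p q) x * h (cyclic_dist m p q) y))"
  using dist_bounds [of p q] entries [of "cyclic_dist m p q" x]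
    entries [of "cyclic_dist m p q" y] assms
  by (auto simp: block_entry_def)

lemma block_row_sum:
  assumes "p < m" "q < m" "x < n" "e \<in> {1, -1}"
  shows "(\<Sum>y<n. 2 * block_entry e c p x q y) = (if p = q then 2 * c * int n else int n)"
proof (cases "p = q")
  case True
  then show ?thesis by (simp add: block_entry_def)
next
  case False
  let ?s = "cyclic_dist m p q"
  have "(\<Sum>y<n. 2 * block_entry e c p x q y) = (\<Sum>y<n. 1 + e * (h ?s x * h ?s y))"
    using assms False by (intro sum.cong refl) (simp add: double_block_entry)
  also have "\<dots> = int n + e * h ?s x * (\<Sum>y<n. h ?s y)"
    by (simp add: sum.distrib sum_distrib_left mult_ac)
  finally show ?thesis
    using False dist_bounds [OF assms(1,2) False] by (simp add: row_sum_zero)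
qed

lemma total_row_sum:
  assumes "p < m" "x < n" "e \<in> {1, -1}"
  shows "(\<Sum>q<m. \<Sum>y<n. block_entry e c p x q y) = int n * (c + int n - 1)"
proof -
  have "2 * (\<Sum>q<m. \<Sum>y<n. block_entry e c p x q y) = (\<Sum>q<m. if p = q then 2 * c * int n else int n)"
    using assms by (simp add: sum_distrib_left block_row_sum)
  also have "\<dots> = 2 * c * int n + (\<Sum>q\<in>{..<m} - {p}. int n)"
    using assms by (simp add: sum.remove [of _ p])
  also have "\<dots> = 2 * (int n * (c + int n - 1))"
    using assms order_ge_2 by (simp add: of_nat_diff int_m algebra_simps)
  finally show ?thesis by simp
qed

text \<open>As rows \<open>s\<close> and \<open>t\<close> sum to zero,
  \<open>C\<^sub>s J = J C\<^sub>t = 0\<close>, and \<open>(J + e C\<^sub>s) (J + e C\<^sub>t) = n J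
  + C\<^sub>s C\<^sub>t\<close>; the sign \<open>e\<close> drops out.\<close>

lemma block_product:
  assumes "p < m" "q < m" "r < m" "r \<noteq> p" "r \<noteq> q" "x < n" "y < n" "e \<in> {1, -1}"
  defines "s \<equiv> cyclic_dist m p r" and "t \<equiv> cyclic_dist m r q"
  shows "(\<Sum>z<n. 4 * (block_entry e c p x r z * block_entry e c r z q y)) =
    (if s = t then int n * (1 + h s x * h s y) else int n)"
proof -
  have st: "s \<in> {1..<n}" "t \<in> {1..<n}"
    using dist_bounds [of p r] dist_bounds [of r q] assms by auto
  have ee: "e * e = 1" using assms by auto
  have "(\<Sum>z<n. 4 * (block_entry e c p x r z * block_entry e c r z q y)) =
      (\<Sum>z<n. (2 * block_entry e c p x r z) * (2 * block_entry e c r z q y))"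
    by (simp add: mult_ac)
  also have "\<dots> = (\<Sum>z<n. (1 + e * (h s x * h s z)) * (1 + e * (h t z * h t y)))"
    using assms by (intro sum.cong refl) (simp add: double_block_entry)
  also have "\<dots> = (\<Sum>z<n. 1 + e * h s x * h s z + e * h t y * h t z
      + (e * e) * h s x * h t y * (h s z * h t z))"
    by (intro sum.cong refl) (simp add: algebra_simps)
  also have "\<dots> = int n + e * h s x * (\<Sum>z<n. h s z) + e * h t y * (\<Sum>z<n. h t z)
      + (e * e) * h s x * h t y * (\<Sum>z<n. h s z * h t z)"
    by (simp only: sum.distrib sum_distrib_left) simp
  finally show ?thesis
    using st by (auto simp: ee row_sum_zero rows algebra_simps)
qed

lemma square_same_block:
  assumes "p < m" "x < n" "y < n" "x \<noteq> y" "e \<in> {1, -1}" "c \<in> {0, 1}"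
  shows "(\<Sum>r<m. \<Sum>z<n. 4 * (block_entry e c p x r z * block_entry e c r z p y)) =
    int n * (4 * c + 2 * int n - 4)"
proof -
  \<comment> \<open>Distinct columns are orthogonal, and row 0 contributes 1 to their
    product.\<close>
  have "(\<Sum>s\<in>{1..<n}. h s x * h s y) = -1"
    using columns [of x y] assms order_ge_2
    by (simp add: lessThan_atLeast0 sum.atLeast_Suc_lessThan first_row)
  moreover have "(\<Sum>r\<in>{..<m} - {p}. \<Sum>z<n. 4 * (block_entry e c p x r z * block_entry e c r z p y)) =
      (\<Sum>r\<in>{..<m} - {p}. int n * (1 + h (cyclic_dist m p r) x * h (cyclic_dist m p r) y))"
    using assms by (intro sum.cong refl, subst block_product)
      (auto simp: cyclic_dist_commute)
  ultimately have "(\<Sum>r\<in>{..<m} - {p}. \<Sum>z<n.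
      4 * (block_entry e c p x r z * block_entry e c r z p y)) = int n * (2 * int (n - 1) - 2)"
    using sum_cyclic_dist [OF assms(1) [unfolded m_def], folded m_def, of "\<lambda>s. int n * (1 + h s x * h s y)"]
    by (simp add: sum.distrib algebra_simps flip: sum_distrib_left)
  \<comment> \<open>Here \<open>c * c = c\<close> is used.\<close>
  moreover have "(\<Sum>z<n. 4 * (block_entry e c p x p z * block_entry e c p z p y)) = 4 * c * int n"
    using assms by (auto simp: block_entry_def)
  ultimately show ?thesis
    using assms order_ge_2 by (simp add: sum.remove [of _ p] of_nat_diff algebra_simps)
qed

text \<open>The terms \<open>r = p\<close> and \<open>r = q\<close> give \<open>2 * c * n\<close>
  each, the midpoint gives \<open>n\<close> times 0 or 2, and each of the other
  \<open>2 * n - 4\<close> blocks gives \<open>n\<close>.\<close>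

lemma square_distinct_blocks:
  assumes "p < m" "q < m" "p \<noteq> q" "x < n" "y < n" "e \<in> {1, -1}"
  shows "(\<Sum>r<m. \<Sum>z<n. 4 * (block_entry e c p x r z * block_entry e c r z q y)) \<in>
    {int n * (4 * c + 2 * int n - 4), int n * (4 * c + 2 * int n - 2)}"
proof -
  let ?F = "\<lambda>r. \<Sum>z<n. 4 * (block_entry e c p x r z * block_entry e c r z q y)"
  obtain r where r: "r < m" "r \<noteq> p" "r \<noteq> q" "cyclic_dist m p r = cyclic_dist m r q"
    and unique: "\<And>r'. \<lbrakk>r' < m; r' \<noteq> p; r' \<noteq> q; cyclic_dist m p r' = cyclic_dist m r' q\<rbrakk>
      \<Longrightarrow> r' = r"
    using cyclic_midpoint [OF assms(1-3) [unfolded m_def], folded m_def] by blast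
  let ?s = "cyclic_dist m p r"
  \<comment> \<open>The constant diagonal block factors out; symmetry turns the remaining column sum
    into a row sum.\<close>
  have "?F p = 2 * c * (\<Sum>z<n. 2 * block_entry e c q y p z)"
    by (simp add: sum_distrib_left block_entry_commute [of e c q y])
      (simp add: block_entry_def mult_ac)
  then have p: "?F p = 2 * c * int n"
    using assms by (simp add: block_row_sum)
  have "?F q = 2 * c * (\<Sum>z<n. 2 * block_entry e c p x q z)"
    by (simp add: sum_distrib_left) (simp add: block_entry_def mult_ac)
  then have q: "?F q = 2 * c * int n"
    using assms by (simp add: block_row_sum)
  have r': "?F r = int n * (1 + h ?s x * h ?s y)"
    using r assms by (simp add: block_product)
  \<comment> \<open>Away from the midpoint the two distances differ, so
    \<open>C\<^sub>s C\<^sub>t = 0\<close> and only \<open>n J\<close> survives.\<close>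
  have "(\<Sum>r'\<in>{..<m} - {p} - {q} - {r}. ?F r') = (\<Sum>r'\<in>{..<m} - {p} - {q} - {r}. int n)"
    using assms unique by (intro sum.cong refl, subst block_product) auto
  also have "\<dots> = int n * (2 * int n - 4)"
  proof -
    have "card ({..<m} - {p} - {q} - {r}) = 2 * n - 4"
      using assms r by (simp add: m_def)
    moreover have "int (2 * n - 4) = 2 * int n - 4"
      using order_ge_2 by simp
    ultimately show ?thesis by simp
  qed
  finally have rest: "(\<Sum>r'\<in>{..<m} - {p} - {q} - {r}. ?F r') = int n * (2 * int n - 4)" .
  have "(\<Sum>r'<m. ?F r') = ?F p + (?F q + (?F r + (\<Sum>r'\<in>{..<m} - {p} - {q} - {r}. ?F r')))"
    using assms r by (simp only: sum.remove [of "{..<m}" p] sum.remove [of "{..<m} - {p}" q]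
      sum.remove [of "{..<m} - {p} - {q}" r] finite_Diff finite_lessThan Diff_iff lessThan_iff
      singleton_iff not_False_eq_True simp_thms)
  then have "(\<Sum>r'<m. ?F r') = int n * (4 * c + 2 * int n - 3 + h ?s x * h ?s y)"
    unfolding p q r' rest by (simp add: algebra_simps)
  moreover have "h ?s x * h ?s y \<in> {1, -1}"
    using entries [of ?s x] entries [of ?s y] dist_bounds [of p r] r assms by auto
  ultimately show ?thesis by auto
qed

section \<open>The assembled matrices and their Deza parameters\<close>

definition block_mat :: "int \<Rightarrow> int \<Rightarrow> int mat" where
  "block_mat e c = mat (m * n) (m * n)
     (\<lambda>(i, j). block_entry e c (i div n) (i mod n) (j div n) (j mod n))"

lemma div_mod_less: "i < m * n \<Longrightarrow> i div n < m \<and> i mod n < n"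
  using order_ge_2 by (simp add: less_mult_imp_div_less)

lemma zero_one_block_mat:
  assumes "e \<in> {1, -1}" "c \<in> {0, 1}"
  shows "zero_one_mat (m * n) (block_mat e c)"
proof -
  have "block_entry e c p x q y = 0 \<or> block_entry e c p x q y = 1"
    if "p < m" "q < m" "x < n" "y < n" for p x q y
    using dist_bounds [of p q] entries [of "cyclic_dist m p q" x]
      entries [of "cyclic_dist m p q" y] assms that
    by (auto simp: block_entry_def)
  then show ?thesis
    by (simp add: zero_one_mat_def block_mat_def div_mod_less)
qed

lemma transpose_block_mat: "transpose_mat (block_mat e c) = block_mat e c"
  by (rule eq_matI) (simp_all add: block_mat_def block_entry_commute)

lemma block_mat_row_sum:
  assumes "e \<in> {1, -1}" "i < m * n"
  shows "(\<Sum>j<m * n. block_mat e c $$ (i, j)) = int n * (c + int n - 1)"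
proof -
  have "(\<Sum>j<m * n. block_mat e c $$ (i, j)) =
      (\<Sum>j<m * n. block_entry e c (i div n) (i mod n) (j div n) (j mod n))"
    using assms by (simp add: block_mat_def)
  then show ?thesis
    using assms by (simp add: sum_div_mod_blocks total_row_sum div_mod_less)
qed

lemma block_mat_square:
  assumes "e \<in> {1, -1}" "c \<in> {0, 1}" "i < m * n" "j < m * n" "i \<noteq> j"
  shows "4 * (block_mat e c * block_mat e c) $$ (i, j) \<in>
    {int n * (4 * c + 2 * int n - 4), int n * (4 * c + 2 * int n - 2)}"
proof -
  let ?f = "\<lambda>r z. 4 * (block_entry e c (i div n) (i mod n) r z *
    block_entry e c r z (j div n) (j mod n))"
  have "4 * (block_mat e c * block_mat e c) $$ (i, j) = (\<Sum>k<m * n. ?f (k div n) (k mod n))"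
    using assms by (simp add: block_mat_def scalar_prod_def sum_distrib_left atLeast0LessThan)
  also have "\<dots> = (\<Sum>r<m. \<Sum>z<n. ?f r z)"
    by (rule sum_div_mod_blocks)
  finally have *: "4 * (block_mat e c * block_mat e c) $$ (i, j) = (\<Sum>r<m. \<Sum>z<n. ?f r z)" .
  show ?thesis
  proof (cases "i div n = j div n")
    case True
    then have "i mod n \<noteq> j mod n"
      using assms by (metis div_mult_mod_eq)
    then show ?thesis
      using square_same_block [of "j div n" "i mod n" "j mod n" e c] assms
      unfolding * True by (simp add: div_mod_less)
  next
    case False
    then show ?thesis
      using square_distinct_blocks [of "i div n" "j div n" "i mod n" "j mod n" e c] assms
      unfolding * by (simp add: div_mod_less)
  qed
qed

text \<open>Row 1 is orthogonal to the constant row, so its \<open>n\<close> odd entries sum to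
  0.\<close>

lemma even_order: "even n"
proof -
  have "{x \<in> {..<n}. odd (h 1 x)} = {..<n}"
    using entries [of 1] order_ge_2 by fastforce
  then have "even (\<Sum>x<n. h 1 x) \<longleftrightarrow> even n"
    by (simp only: even_sum_iff finite_lessThan card_lessThan)
  then show ?thesis
    using row_sum_zero [of 1] order_ge_2 by simp
qed

text \<open>For \<open>c = 0\<close>, dividing \<open>n * (2 * n - 4)\<close> and
  \<open>n * (2 * n - 2)\<close> by 4 gives the two off-diagonal values.\<close>

lemma deza_block_mat:
  assumes "e \<in> {1, -1}"
  shows "deza_adj_mat (m * n) ((n - 1) * n) (n * (n - 1) div 2) (n * (n - 2) div 2) (block_mat e 0)"
proof -
  \<comment> \<open>This form makes all halves exact and removes the truncated subtractions
    \<open>n - 1\<close> and \<open>n - 2\<close>.\<close>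
  obtain k where k: "n = 2 * Suc k"
    using even_order order_ge_2 by (metis evenE not_numeral_le_zero old.nat.exhaust mult_0_right)
  have diag: "block_mat e 0 $$ (i, i) = 0" if "i < m * n" for i
    using that by (simp add: block_mat_def block_entry_def)
  have sums: "(\<Sum>j<m * n. block_mat e 0 $$ (i, j)) = int ((n - 1) * n)" if "i < m * n" for i
    using that assms order_ge_2 by (simp add: block_mat_row_sum of_nat_diff)
  have "(block_mat e 0 * block_mat e 0) $$ (i, j) \<in>
      {int (n * (n - 2) div 2), int (n * (n - 1) div 2)}"
    if "i < m * n" "j < m * n" "i \<noteq> j" for i j
    using block_mat_square [OF assms, of 0 i j] that by (auto simp: k algebra_simps)
  moreover have "n * (n - 2) div 2 \<le> n * (n - 1) div 2"
    by (intro div_le_mono mult_le_mono) auto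
  ultimately show ?thesis
    using zero_one_block_mat [OF assms, of 0] diag sums
    by (simp add: deza_adj_mat_iff transpose_block_mat)
qed

text \<open>For \<open>c = 1\<close> the values are \<open>n * (2 * n)\<close> and
  \<open>n * (2 * n + 2)\<close>, divided by 4.\<close>

lemma deza_reflexive_block_mat:
  assumes "e \<in> {1, -1}"
  shows "deza_reflexive_adj_mat (m * n) (n\<^sup>2) (n * (n + 1) div 2) (n\<^sup>2 div 2) (block_mat e 1)"
proof -
  obtain k where k: "n = 2 * Suc k"
    using even_order order_ge_2 by (metis evenE not_numeral_le_zero old.nat.exhaust mult_0_right)
  have carrier: "block_mat e 1 \<in> carrier_mat (m * n) (m * n)"
    by (simp add: block_mat_def)
  have diag: "block_mat e 1 $$ (i, i) = 1" if "i < m * n" for i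
    using that by (simp add: block_mat_def block_entry_def)
  \<comment> \<open>Removing the loops leaves the adjacency matrix of the underlying simple
    graph.\<close>
  let ?M = "block_mat e 1 - 1\<^sub>m (m * n)"
  have "zero_one_mat (m * n) ?M"
    using zero_one_block_mat [OF assms, of 1] carrier diag
    by (auto simp: zero_one_mat_def)
  moreover have "transpose_mat ?M = ?M"
    using carrier by (simp add: transpose_minus transpose_block_mat)
  moreover have "\<forall>i<m * n. ?M $$ (i, i) = 0"
    using carrier diag by simp
  ultimately obtain E where "simple_graph (m * n) E" "?M = Defs.adj_mat (m * n) E"
    using ex_adj_mat_iff [of "m * n" ?M] by blast
  moreover have "block_mat e 1 = ?M + 1\<^sub>m (m * n)"
    using carrier by (intro eq_matI) auto
  ultimately have "\<exists>E. simple_graph (m * n) E \<and> block_mat e 1 = Defs.adj_mat (m * n) E + 1\<^sub>m (m * n)"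
    by metis
  moreover have "(block_mat e 1 * block_mat e 1) $$ (i, j) \<in>
      {int (n\<^sup>2 div 2), int (n * (n + 1) div 2)}"
    if "i < m * n" "j < m * n" "i \<noteq> j" for i j
    using block_mat_square [OF assms, of 1 i j] that
    by (auto simp: k algebra_simps power2_eq_square)
  ultimately show ?thesis
    using assms by (auto simp: deza_reflexive_adj_mat_def block_mat_row_sum power2_eq_square)
qed

section \<open>The shared diagonal blocks and the two twin structures\<close>

definition block_ones_mat :: "int mat" where
  "block_ones_mat = mat (m * n) (m * n) (\<lambda>(i, j). if i div n = j div n then 1 else 0)"

lemma disjoint_block_mat: "disjoint_mat (m * n) (block_mat 1 0) (block_mat (- 1) 0)"
proof -
  have "\<not> (block_entry 1 0 p x q y = 1 \<and> block_entry (- 1) 0 p x q y = 1)"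
    if "p < m" "q < m" "x < n" "y < n" for p x q y
    using dist_bounds [of p q] entries [of "cyclic_dist m p q" x]
      entries [of "cyclic_dist m p q" y] that
    by (auto simp: block_entry_def)
  then show ?thesis
    by (simp add: disjoint_mat_def block_mat_def div_mod_less)
qed

lemma disjoint_block_ones_mat: "disjoint_mat (m * n) block_ones_mat (block_mat e 0)"
  by (simp add: disjoint_mat_def block_mat_def block_ones_mat_def block_entry_def)

text \<open>This lets the twins \<open>K\<close> and \<open>L\<close> serve again in the Siamese
  pair, with only the diagonal blocks added.\<close>

lemma block_ones_add_block_mat: "block_ones_mat + block_mat e 0 = block_mat e 1"
  by (rule eq_matI) (auto simp: block_mat_def block_ones_mat_def block_entry_def)

text \<open>Row 0 sums to \<open>n * (n - 1)\<close>, which is positive for \<open>n\<close> at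
  least 2.\<close>

lemma block_mat_nonzero:
  assumes "e \<in> {1, -1}"
  shows "block_mat e 0 \<noteq> 0\<^sub>m (m * n) (m * n)"
proof
  assume "block_mat e 0 = 0\<^sub>m (m * n) (m * n)"
  then show False
    using block_mat_row_sum [OF assms, of 0 0] order_ge_2 m_pos by simp
qed

lemma block_ones_mat_nonzero: "block_ones_mat \<noteq> 0\<^sub>m (m * n) (m * n)"
proof
  assume "block_ones_mat = 0\<^sub>m (m * n) (m * n)"
  then have "block_ones_mat $$ (0, 0) = 0"
    using order_ge_2 m_pos by simp
  then show False
    using order_ge_2 m_pos by (simp add: block_ones_mat_def)
qed

lemma twin_deza:
  "twin_deza_graph (m * n) ((n - 1) * n) (n * (n - 1) div 2) (n * (n - 2) div 2)
    (block_mat 1 0 - block_mat (- 1) 0)"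
  unfolding twin_deza_graph_def
  by (rule exI [of _ "block_mat 1 0"], rule exI [of _ "block_mat (- 1) 0"])
    (simp add: zero_one_block_mat block_mat_nonzero disjoint_block_mat deza_block_mat del: One_nat_def)

lemma siamese_twin_deza_reflexive:
  "siamese_twin_deza_reflexive_graph (m * n) (n\<^sup>2) (n * (n + 1) div 2) (n\<^sup>2 div 2)
    block_ones_mat (block_ones_mat + block_mat 1 0 - block_mat (- 1) 0)"
proof -
  have "zero_one_mat (m * n) block_ones_mat"
    by (simp add: zero_one_mat_def block_ones_mat_def)
  then show ?thesis
    unfolding siamese_twin_deza_reflexive_graph_def
    by - (rule exI [of _ "block_mat 1 0"], rule exI [of _ "block_mat (- 1) 0"],
      simp add: zero_one_block_mat block_mat_nonzero block_ones_mat_nonzero disjoint_block_mat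
        disjoint_block_ones_mat block_ones_add_block_mat deza_reflexive_block_mat [simplified])
qed

end

theorem theorem4p1:
  fixes n :: nat
  assumes "n \<ge> 2"
    and "\<exists>H. hadamard_mat n H"
  shows "(\<exists>T. twin_deza_graph ((2 * n - 1) * n) ((n - 1) * n)
              (n * (n - 1) div 2) (n * (n - 2) div 2) T) \<and>
         (\<exists>N S. siamese_twin_deza_reflexive_graph ((2 * n - 1) * n) (n ^ 2)
              (n * (n + 1) div 2) (n ^ 2 div 2) N S)"
proof -
  obtain H where "hadamard_mat n H"
    using assms(2) ..
  then interpret normalized_hadamard n "\<lambda>s x. H $$ (0, x) * H $$ (s, x)"
    using assms(1) by (rule hadamard_mat_normalize)
  show ?thesis
    using twin_deza [unfolded m_def] siamese_twin_deza_reflexive [unfolded m_def] by blast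
qed

end
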